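(* If $f\in L^1(\mathbb{T})$ then $$\sigma_n(f)=F_n*f\to f\ \text{ a.e. as } n\to\infty,$$ $$P_r*f\to f\ \text{ a.e. as } r\nearrow 1,$$ $$L_h*f\to f\ \text{ a.e. as } h\searrow 0 .$$
   Context: $\mathbb{T}=\mathbb{R}/2\pi\mathbb{Z}$; functions are complex-valued and $2\pi$-periodic. Convolution is $(f*g)(t)=\frac{1}{2\pi}\int_{\mathbb{T}}f(t-\tau)g(\tau)\,d\tau$. With $\hat f(j)=\frac{1}{2\pi}\int_{\mathbb{T}}f(t)e^{-ijt}\,dt$ and $S_n(f)(t)=\sum_{j=-n}^n\hat f(j)e^{ijt}$, set $\sigma_n(f)=\frac{S_0(f)+\cdots+S_n(f)}{n+1}$. The Fejér kernel is $F_n(t)=\sum_{j=-n}^n\big(1-\frac{|j|}{n+1}\big)e^{ijt}$, $n\ge0$. The Poisson kernel is $P_r(t)=\sum_{j=-\infty}^{\infty}r^{|j|}e^{ijt}=\frac{1-r^2}{1-2r\cos t+r^2}$, $0<r<1$. The Lebesgue kernel is $L_h(t)=2\pi\frac{1}{2h}\mathbf{1}_{[-h,h]}(t)$ on $[-\pi,\pi)$, extended $2\pi$-periodically, $0<h<\pi$, so that $(L_h*f)(t)=\frac{1}{2h}\int_{t-h}^{t+h}f(\tau)\,d\tau$. *)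

theory Defs
  imports "HOL-Analysis.Analysis" "HOL-Library.Real_Mod"
begin

text \<open>
  Functions on the circle are modelled as \<open>2\<pi>\<close>-periodic functions on the real line,
  and integrals over the circle as Lebesgue integrals over the period \<open>[-\<pi>, \<pi>]\<close>.
\<close>

definition periodic_2pi :: "(real \<Rightarrow> complex) \<Rightarrow> bool" where
  "periodic_2pi f \<longleftrightarrow> (\<forall>t. f (t + 2 * pi) = f t)"

definition L1_circle :: "(real \<Rightarrow> complex) set" where
  "L1_circle = {f. periodic_2pi f \<and> f absolutely_integrable_on {-pi..pi}}"

definition circle_mean :: "(real \<Rightarrow> complex) \<Rightarrow> complex" where
  "circle_mean f = complex_of_real (1 / (2 * pi)) * (LINT t:{-pi..pi}|lebesgue. f t)"

definition circle_conv :: "(real \<Rightarrow> complex) \<Rightarrow> (real \<Rightarrow> complex) \<Rightarrow> real \<Rightarrow> complex" where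
  "circle_conv f g t = circle_mean (\<lambda>\<tau>. f (t - \<tau>) * g \<tau>)"

definition fourier_coeff :: "(real \<Rightarrow> complex) \<Rightarrow> int \<Rightarrow> complex" where
  "fourier_coeff f j = circle_mean (\<lambda>t. f t * cis (- (of_int j * t)))"

definition fourier_partial_sum :: "nat \<Rightarrow> (real \<Rightarrow> complex) \<Rightarrow> real \<Rightarrow> complex" where
  "fourier_partial_sum n f t = (\<Sum>j = - int n..int n. fourier_coeff f j * cis (of_int j * t))"

definition cesaro_mean :: "nat \<Rightarrow> (real \<Rightarrow> complex) \<Rightarrow> real \<Rightarrow> complex" where
  "cesaro_mean n f t = (\<Sum>k\<le>n. fourier_partial_sum k f t) / of_nat (n + 1)"

definition fejer_kernel :: "nat \<Rightarrow> real \<Rightarrow> complex" where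
  "fejer_kernel n t =
     (\<Sum>j = - int n..int n. complex_of_real (1 - of_int \<bar>j\<bar> / of_nat (n + 1)) * cis (of_int j * t))"

definition poisson_kernel :: "real \<Rightarrow> real \<Rightarrow> complex" where
  "poisson_kernel r t = (\<Sum>\<^sub>\<infinity>j::int. complex_of_real (r ^ nat \<bar>j\<bar>) * cis (of_int j * t))"

text \<open>
  The argument \<open>(t + \<pi>) rmod (2\<pi>) - \<pi>\<close> is the representative of \<open>t\<close> modulo \<open>2\<pi>\<close> in
  \<open>[-\<pi>, \<pi>)\<close>, so this is the periodic extension of the kernel from that interval.
\<close>

definition lebesgue_kernel :: "real \<Rightarrow> real \<Rightarrow> complex" where
  "lebesgue_kernel h t =
     complex_of_real (2 * pi * (1 / (2 * h)) * indicator {-h..h} ((t + pi) rmod (2 * pi) - pi))"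

lemma poisson_kernel_closed_form:
  assumes "0 < r" "r < 1"
  shows "poisson_kernel r t = complex_of_real ((1 - r\<^sup>2) / (1 - 2 * r * cos t + r\<^sup>2))"
proof -
  define z where "z = complex_of_real r * cis t"
  have nz: "norm z < 1" "norm (cnj z) < 1"
    using assms by (simp_all add: z_def norm_mult)
  let ?g = "\<lambda>j::int. complex_of_real (r ^ nat \<bar>j\<bar>) * cis (of_int j * t)"
  have geo: "((\<lambda>n. w ^ n) has_sum (1 / (1 - w))) UNIV" if "norm w < 1" for w :: complex
    by (rule norm_summable_imp_has_sum)
       (use that in \<open>auto simp: norm_power intro!: summable_geometric geometric_sums\<close>)
  have "?g (int n) = z ^ n" for n
    by (simp only: z_def power_mult_distrib Complex.DeMoivre) simp
  hence pos: "(?g has_sum (1 / (1 - z))) (int ` UNIV)"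
    using geo[OF nz(1)] by (subst has_sum_reindex) (simp_all only: o_def inj_on_of_nat)
  have "((\<lambda>n. cnj z * cnj z ^ n) has_sum (cnj z * (1 / (1 - cnj z)))) UNIV"
    by (intro has_sum_cmult_right geo nz)
  moreover have "?g (- int (Suc n)) = cnj z * cnj z ^ n" for n
  proof -
    have "nat \<bar>- int (Suc n)\<bar> = Suc n" "of_int (- int (Suc n)) * t = real (Suc n) * - t"
      by (simp_all add: algebra_simps)
    hence "?g (- int (Suc n)) = cnj z ^ Suc n"
      by (simp only: z_def complex_cnj_mult cis_cnj complex_cnj_complex_of_real of_real_power
            power_mult_distrib Complex.DeMoivre)
    thus ?thesis by simp
  qed
  moreover have "inj (\<lambda>n. - int (Suc n))"
    by (auto simp: inj_on_def)
  ultimately have neg: "(?g has_sum (cnj z * (1 / (1 - cnj z)))) ((\<lambda>n. - int (Suc n)) ` UNIV)"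
    by (subst has_sum_reindex) (simp_all only: o_def)
  have UN: "(int ` UNIV) \<union> ((\<lambda>n. - int (Suc n)) ` UNIV) = UNIV"
  proof (intro equalityI subsetI UNIV_I)
    fix x :: int
    show "x \<in> (int ` UNIV) \<union> ((\<lambda>n. - int (Suc n)) ` UNIV)"
      by (cases x) auto
  qed
  have "(?g has_sum (1 / (1 - z) + cnj z * (1 / (1 - cnj z)))) UNIV"
    using has_sum_Un_disjoint[OF pos neg] unfolding UN by fastforce
  hence *: "poisson_kernel r t = 1 / (1 - z) + cnj z * (1 / (1 - cnj z))"
    unfolding poisson_kernel_def by (rule infsumI)
  have ne: "1 - z \<noteq> 0" "1 - cnj z \<noteq> 0" using nz by auto
  have zz: "z * cnj z = complex_of_real (r\<^sup>2)"
    using assms complex_norm_square[of z] by (simp add: z_def norm_mult)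
  have zs: "z + cnj z = complex_of_real (2 * r * cos t)"
    using complex_add_cnj[of z] by (simp add: z_def)
  have "1 / (1 - z) + cnj z * (1 / (1 - cnj z)) = (1 - z * cnj z) / ((1 - z) * (1 - cnj z))"
    using ne by (simp add: field_simps)
  also have "(1 - z) * (1 - cnj z) = 1 - (z + cnj z) + z * cnj z"
    by (simp add: algebra_simps)
  finally show ?thesis unfolding * zz zs by simp
qed

end

theory Submission
  imports Defs
begin

text \<open>
  All three families converge to \<open>f\<close> at every Lebesgue point of \<open>f\<close>, that is, wherever the mean of
  \<open>\<bar>f - f t\<bar>\<close> over \<open>[t - h, t + h]\<close> tends to zero with \<open>h\<close>; almost every \<open>t\<close> is such a point
  (\<open>AE_lebesgue_point\<close>).

  What the three kernels have in common is that they have mean one and lie below a multiple of the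
  Cauchy weight \<open>d / (d\<^sup>2 + s\<^sup>2)\<close> on \<open>[-\<pi>, \<pi>]\<close>, where the width \<open>d\<close> is \<open>1 / (n + 1)\<close> for Fejer,
  \<open>1 - r\<close> for Poisson and \<open>h\<close> for Lebesgue, and the multiple does not depend on it
  (\<open>peaked_kernel_fejer\<close>, \<open>peaked_kernel_poisson\<close>, \<open>peaked_kernel_lebesgue\<close>). Mean one turns
  \<open>K * f - f t\<close> into the mean of \<open>K (t - s) (f s - f t)\<close>, which is at most a multiple of
  the integral of \<open>d / (d\<^sup>2 + (s - t)\<^sup>2) \<bar>f s - f t\<bar>\<close>. Away from \<open>t\<close> the weight tends to zero
  uniformly with \<open>d\<close>. Near \<open>t\<close> the weight is, up to a constant, a sum over dyadic intervals around
  \<open>t\<close>, so the integral is controlled by the means of \<open>\<bar>f - f t\<bar>\<close> over these intervals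
  (\<open>cauchy_weight_integral_le\<close>). At a Lebesgue point these means are small, which proves the
  convergence for all three kernels at once (\<open>circle_conv_tendsto_at_lebesgue_point\<close>).

  The identity of the Cesaro means with the Fejer convolutions is a rearrangement of finite sums.
\<close>

section \<open>Integrals of periodic functions\<close>

lemma absolutely_integrable_on_shift_Icc_real:
  fixes g :: "real \<Rightarrow> 'b::euclidean_space"
  shows "(\<lambda>x. g (x + c)) absolutely_integrable_on {a..b} \<longleftrightarrow> g absolutely_integrable_on {a + c..b + c}"
  using integrable_on_shift_Icc_real[of g c a b] integrable_on_shift_Icc_real[of "\<lambda>x. norm (g x)" c a b]
  by (simp add: absolutely_integrable_on_def o_def add.commute)

lemma integral_shift_Icc_real:
  fixes g :: "real \<Rightarrow> 'b::euclidean_space"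
  assumes "g integrable_on {a + c..b + c}"
  shows "integral {a..b} (\<lambda>x. g (x + c)) = integral {a + c..b + c} g"
proof -
  have "((\<lambda>x. g (1 *\<^sub>R x + c)) has_integral (integral {a + c..b + c} g /\<^sub>R 1 ^ DIM(real)))
      (cbox ((a + c - c) /\<^sub>R 1) ((b + c - c) /\<^sub>R 1))"
    by (rule has_integral_affinity') (use assms in \<open>auto simp: integrable_integral\<close>)
  thus ?thesis by (intro integral_unique) simp
qed

lemma periodic_absolutely_integrable_on_Icc:
  fixes g :: "real \<Rightarrow> complex"
  assumes per: "periodic_2pi g" and int: "g absolutely_integrable_on {a..a + 2 * pi}"
  shows "g absolutely_integrable_on {c..d}"
proof -
  have up: "g absolutely_integrable_on {u + 2 * pi..v + 2 * pi}"
    if "g absolutely_integrable_on {u..v}" for u v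
    using that per absolutely_integrable_on_shift_Icc_real[where g = g and c = "2 * pi" and a = u and b = v]
    by (simp add: periodic_2pi_def)
  have down: "g absolutely_integrable_on {u - 2 * pi..v - 2 * pi}"
    if "g absolutely_integrable_on {u..v}" for u v
    using that per absolutely_integrable_on_shift_Icc_real[where g = g and c = "2 * pi" and a = "u - 2 * pi" and b = "v - 2 * pi"]
    by (simp add: periodic_2pi_def)
  \<comment> \<open>An interval and its two translates by a period fill an interval that is longer by a period at each end.\<close>
  have wide: "g absolutely_integrable_on {a - 2 * pi * real n..a + 2 * pi + 2 * pi * real n}" for n
  proof (induction n)
    case 0
    thus ?case using int by simp
  next
    case (Suc n)
    let ?u = "a - 2 * pi * real n" and ?v = "a + 2 * pi + 2 * pi * real n"
    have three: "{u - p..v - p} \<union> {u..v} \<union> {u + p..v + p} = {u - p..v + p}"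
      if "p > 0" "u + p \<le> v" for u v p :: real
      using that by auto
    have "g absolutely_integrable_on ({?u - 2 * pi..?v - 2 * pi} \<union> {?u..?v} \<union> {?u + 2 * pi..?v + 2 * pi})"
      using Suc up[OF Suc] down[OF Suc] by (intro absolutely_integrable_Un)
    also have "{?u - 2 * pi..?v - 2 * pi} \<union> {?u..?v} \<union> {?u + 2 * pi..?v + 2 * pi} = {?u - 2 * pi..?v + 2 * pi}"
      by (rule three) auto
    also have "?u - 2 * pi = a - 2 * pi * real (Suc n)" by (simp add: algebra_simps)
    also have "?v + 2 * pi = a + 2 * pi + 2 * pi * real (Suc n)" by (simp add: algebra_simps)
    finally show ?case .
  qed
  obtain n :: nat where n: "max (a - c) (d - a) / (2 * pi) < real n"
    using reals_Archimedean2 by blast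
  hence "max (a - c) (d - a) < 2 * pi * real n"
    by (simp add: field_simps)
  hence "{c..d} \<subseteq> {a - 2 * pi * real n..a + 2 * pi + 2 * pi * real n}"
    unfolding atLeastatMost_subset_iff max_less_iff_conj using pi_gt_zero by linarith
  thus ?thesis by (rule absolutely_integrable_on_subinterval[OF wide])
qed

text \<open>
  The integrals over \<open>[b, b + 2\<pi>]\<close> and \<open>[c, c + 2\<pi>]\<close> differ by those over \<open>[b, c]\<close> and its translate
  by a period.
\<close>

lemma periodic_integral_any_period:
  fixes g :: "real \<Rightarrow> complex"
  assumes per: "periodic_2pi g" and int: "g absolutely_integrable_on {a..a + 2 * pi}"
  shows "integral {b..b + 2 * pi} g = integral {c..c + 2 * pi} g"
proof -
  have g: "g integrable_on {u..v}" for u v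
    using periodic_absolutely_integrable_on_Icc[OF assms]
    by (simp add: set_lebesgue_integral_eq_integral(1))
  have *: "integral {b..b + 2 * pi} g = integral {c..c + 2 * pi} g" if "b \<le> c" for b c
  proof -
    have "integral {b..b + 2 * pi} g + integral {b + 2 * pi..c + 2 * pi} g = integral {b..c + 2 * pi} g"
      by (rule Henstock_Kurzweil_Integration.integral_combine) (use that g in auto)
    also have "\<dots> = integral {b..c} g + integral {c..c + 2 * pi} g"
      by (rule Henstock_Kurzweil_Integration.integral_combine[symmetric]) (use that g in auto)
    also have "integral {b + 2 * pi..c + 2 * pi} g = integral {b..c} g"
      using integral_shift_Icc_real[where g = g and a = b and c = "2 * pi" and b = c, OF g] per by (simp add: periodic_2pi_def)
    finally show ?thesis by simp
  qed
  show ?thesis by (metis * linear)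
qed

text \<open>
  For \<open>a = t - \<pi>\<close> this places the period around \<open>t\<close>, so that the argument \<open>t - s\<close> of the
  kernel in a convolution stays in \<open>[-\<pi>, \<pi>]\<close>.
\<close>

lemma circle_mean_eq_integral:
  assumes per: "periodic_2pi g" and int: "g absolutely_integrable_on {a..a + 2 * pi}"
  shows "circle_mean g = complex_of_real (1 / (2 * pi)) * integral {a..a + 2 * pi} g"
proof -
  have "g absolutely_integrable_on {-pi..pi}"
    by (rule periodic_absolutely_integrable_on_Icc[OF assms])
  hence "(LINT t:{-pi..pi}|lebesgue. g t) = integral {-pi..-pi + 2 * pi} g"
    by (simp add: set_lebesgue_integral_eq_integral(2))
  also have "\<dots> = integral {a..a + 2 * pi} g"
    by (rule periodic_integral_any_period[OF assms])
  finally show ?thesis by (simp add: circle_mean_def)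
qed

lemma L1_circle_absolutely_integrable:
  assumes "f \<in> L1_circle"
  shows "f absolutely_integrable_on {a..b}"
  using assms periodic_absolutely_integrable_on_Icc[of f "-pi"] by (auto simp: L1_circle_def)

section \<open>Lebesgue points\<close>

definition lebesgue_point :: "(real \<Rightarrow> 'b::euclidean_space) \<Rightarrow> real \<Rightarrow> bool" where
  "lebesgue_point f t \<longleftrightarrow>
     (\<forall>e>0. \<exists>d>0. \<forall>h. 0 < h \<and> h < d \<longrightarrow> integral {t - h..t + h} (\<lambda>s. norm (f s - f t)) \<le> e * h)"

lemma absolutely_integrable_norm_diff_const:
  fixes f :: "real \<Rightarrow> 'b::euclidean_space"
  assumes "f absolutely_integrable_on {a..b}"
  shows "(\<lambda>s. norm (f s - c)) absolutely_integrable_on {a..b}"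
  using absolutely_integrable_norm[OF set_integral_diff(1)[OF assms absolutely_integrable_on_const[of _ c]]]
  by (simp add: o_def)

lemma integrable_norm_diff_const:
  fixes f :: "real \<Rightarrow> 'b::euclidean_space"
  assumes "f absolutely_integrable_on {a..b}"
  shows "(\<lambda>s. norm (f s - c)) integrable_on {a..b}"
  using absolutely_integrable_norm_diff_const[OF assms] 
  by (simp add: set_lebesgue_integral_eq_integral(1))

text \<open>
  Lebesgue differentiation applies to \<open>s \<mapsto> \<bar>f s - c\<bar>\<close> for each fixed \<open>c\<close>, but here \<open>c = f t\<close> varies with
  the point. It is enough to treat countably many dense \<open>c\<close>, since replacing \<open>f t\<close> by a nearby \<open>c\<close>
  changes the means by at most the distance of the two. The differentiation theorem is about
  intervals to the right of the point.
\<close>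

lemma right_lebesgue_point_negligible:
  fixes f :: "real \<Rightarrow> 'b::euclidean_space"
  assumes f: "\<And>a b. f absolutely_integrable_on {a..b}"
  obtains N where "negligible N"
    "\<And>t e. \<lbrakk>t \<notin> N; e > 0\<rbrakk> \<Longrightarrow>
       \<exists>d>0. \<forall>h. 0 < h \<and> h < d \<longrightarrow> integral {t..t + h} (\<lambda>s. norm (f s - f t)) \<le> e * h"
proof -
  obtain D :: "'b set" where D: "countable D" "\<And>X. \<lbrakk>open X; X \<noteq> {}\<rbrakk> \<Longrightarrow> \<exists>d\<in>D. d \<in> X"
    using countable_dense_setE by (metis)
  have "\<exists>N. negligible N \<and> (\<forall>t e. t \<notin> N \<longrightarrow> 0 < e \<longrightarrow> (\<exists>d>0. \<forall>h. 0 < h \<and> h < d \<longrightarrow>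
      \<bar>integral {t..t + h} (\<lambda>s. norm (f s - c)) / h - norm (f t - c)\<bar> < e))" for c
  proof -
    have "(\<lambda>s. norm (f s - c)) integrable_on cbox a b" for a b
      using integrable_norm_diff_const[OF f] by simp
    from integrable_ccontinuous_explicit[OF this] obtain N where "negligible N"
      "\<And>x e. \<lbrakk>x \<notin> N; 0 < e\<rbrakk> \<Longrightarrow> \<exists>d>0. \<forall>h. 0 < h \<and> h < d \<longrightarrow>
         norm (integral (cbox x (x + h *\<^sub>R One)) (\<lambda>s. norm (f s - c)) /\<^sub>R h ^ DIM(real) - norm (f x - c)) < e"
      by metis
    thus ?thesis by (intro exI[of _ N]) (auto simp: divide_inverse mult.commute)
  qed
  then obtain N where N: "\<And>c. negligible (N c)" "\<And>c t e. \<lbrakk>t \<notin> N c; 0 < e\<rbrakk> \<Longrightarrow>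
      (\<exists>d>0. \<forall>h. 0 < h \<and> h < d \<longrightarrow>
        \<bar>integral {t..t + h} (\<lambda>s. norm (f s - c)) / h - norm (f t - c)\<bar> < e)"
    by metis
  show ?thesis
  proof
    show "negligible (\<Union>c\<in>D. N c)"
      using D(1) N(1) by (intro negligible_countable_Union) auto
  next
    fix t and e :: real
    assume t: "t \<notin> (\<Union>c\<in>D. N c)" and e: "e > 0"
    obtain c where c: "c \<in> D" "c \<in> ball (f t) (e / 4)"
      using D(2)[of "ball (f t) (e / 4)"] e by auto
    hence ct: "norm (f t - c) < e / 4" by (simp add: dist_norm)
    obtain d where d: "d > 0" "\<And>h. \<lbrakk>0 < h; h < d\<rbrakk> \<Longrightarrow>
        \<bar>integral {t..t + h} (\<lambda>s. norm (f s - c)) / h - norm (f t - c)\<bar> < e / 4"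
      using N(2)[of t c "e / 4"] t c(1) e by auto
    have "integral {t..t + h} (\<lambda>s. norm (f s - f t)) \<le> e * h" if h: "0 < h" "h < d" for h
    proof -
      have "integral {t..t + h} (\<lambda>s. norm (f s - f t))
          \<le> integral {t..t + h} (\<lambda>s. norm (f s - c) + norm (f t - c))"
        by (intro integral_le integrable_add integrable_norm_diff_const f)
           (use norm_triangle_ineq4[of "f s - c" "f t - c" for s] in auto)
      also have "\<dots> = integral {t..t + h} (\<lambda>s. norm (f s - c)) + norm (f t - c) * h"
        by (subst Henstock_Kurzweil_Integration.integral_add)
           (use h in \<open>auto intro!: integrable_norm_diff_const f\<close>)
      also have "\<dots> \<le> (norm (f t - c) + e / 4) * h + norm (f t - c) * h"
      proof -
        have "integral {t..t + h} (\<lambda>s. norm (f s - c)) / h < norm (f t - c) + e / 4"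
          using d(2)[OF h] by linarith
        thus ?thesis using h by (simp add: field_simps)
      qed
      also have "\<dots> = (2 * norm (f t - c) + e / 4) * h" by (simp add: algebra_simps)
      also have "\<dots> \<le> e * h"
        using ct h e by (intro mult_right_mono) linarith+
      finally show ?thesis .
    qed
    thus "\<exists>d>0. \<forall>h. 0 < h \<and> h < d \<longrightarrow> integral {t..t + h} (\<lambda>s. norm (f s - f t)) \<le> e * h"
      using d(1) by blast
  qed
qed

text \<open>
  The intervals to the left of \<open>t\<close> are covered by the one-sided result for the reflected function.
\<close>

lemma AE_lebesgue_point:
  fixes f :: "real \<Rightarrow> 'b::euclidean_space"
  assumes f: "\<And>a b. f absolutely_integrable_on {a..b}"
  shows "AE t in lebesgue. lebesgue_point f t"
proof -
  obtain N1 where N1: "negligible N1" "\<And>t e. \<lbrakk>t \<notin> N1; e > 0\<rbrakk> \<Longrightarrow>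
       \<exists>d>0. \<forall>h. 0 < h \<and> h < d \<longrightarrow> integral {t..t + h} (\<lambda>s. norm (f s - f t)) \<le> e * h"
    using right_lebesgue_point_negligible[of f, OF f] by blast
  have f': "(\<lambda>s. f (- s)) absolutely_integrable_on {a..b}" for a b
    using f[of "-b" "-a"] absolutely_integrable_reflect_real[where f = f and a = "- b" and b = "- a"] by simp
  obtain N2 where N2: "negligible N2" "\<And>t e. \<lbrakk>t \<notin> N2; e > 0\<rbrakk> \<Longrightarrow>
       \<exists>d>0. \<forall>h. 0 < h \<and> h < d \<longrightarrow> integral {t..t + h} (\<lambda>s. norm (f (- s) - f (- t))) \<le> e * h"
    using right_lebesgue_point_negligible[of "\<lambda>s. f (- s)", OF f'] by blast
  have "negligible (N1 \<union> uminus ` N2)"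
    using N1(1) N2(1)
    by (intro negligible_Un negligible_differentiable_image_negligible)
       (auto intro!: differentiable_on_minus differentiable_on_ident)
  moreover have "lebesgue_point f t" if t: "t \<notin> N1 \<union> uminus ` N2" for t
    unfolding lebesgue_point_def
  proof (intro allI impI)
    fix e :: real assume "e > 0"
    hence e: "e / 2 > 0" by simp
    have t': "t \<notin> N1" "- t \<notin> N2" using t by (auto simp: image_iff)
    obtain d1 where d1: "d1 > 0" "\<And>h. \<lbrakk>0 < h; h < d1\<rbrakk> \<Longrightarrow>
        integral {t..t + h} (\<lambda>s. norm (f s - f t)) \<le> e / 2 * h"
      using N1(2)[OF t'(1) e] by blast
    obtain d2 where d2: "d2 > 0" "\<And>h. \<lbrakk>0 < h; h < d2\<rbrakk> \<Longrightarrow>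
        integral {-t..-t + h} (\<lambda>s. norm (f (- s) - f t)) \<le> e / 2 * h"
      using N2(2)[OF t'(2) e] by auto
    have "integral {t - h..t + h} (\<lambda>s. norm (f s - f t)) \<le> e * h"
      if h: "0 < h" "h < min d1 d2" for h
    proof -
      have "integral {t - h..t + h} (\<lambda>s. norm (f s - f t)) =
          integral {t - h..t} (\<lambda>s. norm (f s - f t)) + integral {t..t + h} (\<lambda>s. norm (f s - f t))"
        by (rule Henstock_Kurzweil_Integration.integral_combine[symmetric])
           (use h in \<open>auto intro!: integrable_norm_diff_const f\<close>)
      also have "integral {t - h..t} (\<lambda>s. norm (f s - f t))
          = integral {-t..-t + h} (\<lambda>s. norm (f (- s) - f t))"
        using Henstock_Kurzweil_Integration.integral_reflect_real[of t "t - h" "\<lambda>s. norm (f s - f t)"]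
        by (simp add: algebra_simps)
      finally show ?thesis using d1(2)[of h] d2(2)[of h] h by simp
    qed
    thus "\<exists>d>0. \<forall>h. 0 < h \<and> h < d \<longrightarrow> integral {t - h..t + h} (\<lambda>s. norm (f s - f t)) \<le> e * h"
      using d1(1) d2(1) by (intro exI[of _ "min d1 d2"]) auto
  qed
  ultimately show ?thesis
    unfolding eventually_ae_filter_negligible by blast
qed

section \<open>Convergence at Lebesgue points\<close>

text \<open>
  The Cauchy weight is comparable to \<open>1 / d\<close> for \<open>\<bar>s\<bar> \<le> d\<close> and to \<open>d / s\<^sup>2\<close> beyond: a kernel of width \<open>d\<close>
  whose tails decay quadratically.
\<close>

definition peaked_kernel :: "real \<Rightarrow> real \<Rightarrow> (real \<Rightarrow> complex) \<Rightarrow> bool" where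
  "peaked_kernel C d K \<longleftrightarrow> C \<ge> 0 \<and> d > 0 \<and> periodic_2pi K \<and> K \<in> borel_measurable borel \<and>
     circle_mean K = 1 \<and> (\<forall>s\<in>{-pi..pi}. norm (K s) \<le> C * (d / (d\<^sup>2 + s\<^sup>2)))"

lemma cauchy_weight_mult_absolutely_integrable:
  fixes g :: "real \<Rightarrow> real"
  assumes "g absolutely_integrable_on {a..b}" "d > 0"
  shows "(\<lambda>s. d / (d\<^sup>2 + (s - t)\<^sup>2) * g s) absolutely_integrable_on {a..b}"
proof (rule absolutely_integrable_bounded_measurable_product_real)
  have cont: "continuous_on A (\<lambda>s. d / (d\<^sup>2 + (s - t)\<^sup>2))" for A
  proof (intro continuous_intros ballI)
    fix s show "d\<^sup>2 + (s - t)\<^sup>2 \<noteq> 0"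
      using assms(2) by (simp add: add_pos_nonneg less_imp_neq[symmetric])
  qed
  show "(\<lambda>s. d / (d\<^sup>2 + (s - t)\<^sup>2)) \<in> borel_measurable (lebesgue_on {a..b})"
    by (intro continuous_imp_measurable_on_sets_lebesgue cont) auto
  show "bounded ((\<lambda>s. d / (d\<^sup>2 + (s - t)\<^sup>2)) ` {a..b})"
    by (intro compact_imp_bounded compact_continuous_image cont) auto
qed (use assms in auto)

text \<open>
  Outside the inner interval the weight \<open>d / (d\<^sup>2 + (s - t)\<^sup>2)\<close> is at most \<open>d / k\<^sup>2\<close>.
\<close>

lemma cauchy_weight_integral_split:
  fixes g :: "real \<Rightarrow> real"
  assumes g: "\<And>a b. g absolutely_integrable_on {a..b}" and nonneg: "\<And>s. g s \<ge> 0"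
    and "d > 0" "0 < k" "k \<le> h"
  shows "integral {t - h..t + h} (\<lambda>s. d / (d\<^sup>2 + (s - t)\<^sup>2) * g s)
    \<le> integral {t - k..t + k} (\<lambda>s. d / (d\<^sup>2 + (s - t)\<^sup>2) * g s) + d / k\<^sup>2 * integral {t - h..t + h} g"
proof -
  define w where "w = (\<lambda>s. d / (d\<^sup>2 + (s - t)\<^sup>2))"
  have gi: "g integrable_on {a..b}" for a b
    using g by (simp add: set_lebesgue_integral_eq_integral(1))
  have wgi: "(\<lambda>s. w s * g s) integrable_on {a..b}" for a b
    unfolding w_def using cauchy_weight_mult_absolutely_integrable[OF g \<open>d > 0\<close>]
    by (simp add: set_lebesgue_integral_eq_integral(1))
  have three: "integral {t - h..t + h} u =
      integral {t - h..t - k} u + integral {t - k..t + k} u + integral {t + k..t + h} u"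
    if "\<And>a b. u integrable_on {a..b}" for u :: "real \<Rightarrow> real"
    using Henstock_Kurzweil_Integration.integral_combine[of "t - h" "t - k" "t + h" u]
      Henstock_Kurzweil_Integration.integral_combine[of "t - k" "t + k" "t + h" u] that assms
    by simp
  have outer: "integral {a..b} (\<lambda>s. w s * g s) \<le> d / k\<^sup>2 * integral {a..b} g"
    if "\<And>s. s \<in> {a..b} \<Longrightarrow> k \<le> \<bar>s - t\<bar>" for a b
  proof -
    have "w s * g s \<le> d / k\<^sup>2 * g s" if s: "s \<in> {a..b}" for s
    proof -
      have "k\<^sup>2 \<le> (s - t)\<^sup>2"
        using that s \<open>\<And>s. s \<in> {a..b} \<Longrightarrow> k \<le> \<bar>s - t\<bar>\<close> \<open>0 < k\<close> power_mono[of k "\<bar>s - t\<bar>" 2] by simp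
      hence "k\<^sup>2 \<le> d\<^sup>2 + (s - t)\<^sup>2" by (simp add: add_increasing)
      hence "w s \<le> d / k\<^sup>2"
        unfolding w_def using assms by (intro divide_left_mono mult_pos_pos add_pos_nonneg) auto
      thus ?thesis by (intro mult_right_mono nonneg)
    qed
    hence "integral {a..b} (\<lambda>s. w s * g s) \<le> integral {a..b} (\<lambda>s. d / k\<^sup>2 * g s)"
      by (intro integral_le wgi integrable_on_mult_right gi) auto
    thus ?thesis by simp
  qed
  have mid: "0 \<le> d / k\<^sup>2 * integral {t - k..t + k} g"
    using assms by (intro mult_nonneg_nonneg integral_nonneg gi nonneg) auto
  have "integral {t - h..t + h} (\<lambda>s. w s * g s) \<le> integral {t - k..t + k} (\<lambda>s. w s * g s)
      + (d / k\<^sup>2 * integral {t - h..t - k} g + d / k\<^sup>2 * integral {t + k..t + h} g)"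
    using three[OF wgi] outer[of "t - h" "t - k"] outer[of "t + k" "t + h"] by fastforce
  also have "\<dots> \<le> integral {t - k..t + k} (\<lambda>s. w s * g s) + d / k\<^sup>2 * integral {t - h..t + h} g"
    using three[OF gi] mid by (simp add: algebra_simps)
  finally show ?thesis by (simp add: w_def)
qed

text \<open>
  Halving \<open>h\<close> costs at most \<open>2 d e / (h / 2)\<close>, and these costs form a geometric series that is
  dominated by its last term, where \<open>h\<close> is comparable to \<open>d\<close>. The total is therefore at most
  \<open>6 * e\<close>; the subtracted \<open>4 * d / h\<close> is what makes the induction over the halvings close.
\<close>

lemma cauchy_weight_integral_le:
  fixes g :: "real \<Rightarrow> real"
  assumes g: "\<And>a b. g absolutely_integrable_on {a..b}" and nonneg: "\<And>s. g s \<ge> 0"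
    and avg: "\<And>h. \<lbrakk>0 < h; h \<le> r\<rbrakk> \<Longrightarrow> integral {t - h..t + h} g \<le> e * h"
    and "e \<ge> 0" "0 < d" "d \<le> h" "h \<le> r"
  shows "integral {t - h..t + h} (\<lambda>s. d / (d\<^sup>2 + (s - t)\<^sup>2) * g s) \<le> (6 - 4 * d / h) * e"
proof -
  let ?J = "\<lambda>h. integral {t - h..t + h} (\<lambda>s. d / (d\<^sup>2 + (s - t)\<^sup>2) * g s)"
  \<comment> \<open>For \<open>h\<close> comparable to \<open>d\<close> the crude bound of the weight by \<open>1 / d\<close> is good enough.\<close>
  have small: "?J h \<le> (6 - 4 * d / h) * e" if h: "d \<le> h" "h \<le> 2 * d" "h \<le> r" for h
  proof -
    have "?J h \<le> integral {t - h..t + h} (\<lambda>s. 1 / d * g s)"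
    proof (intro integral_le integrable_on_mult_right)
      show "(\<lambda>s. d / (d\<^sup>2 + (s - t)\<^sup>2) * g s) integrable_on {t - h..t + h}"
        using cauchy_weight_mult_absolutely_integrable[OF g \<open>0 < d\<close>]
        by (simp add: set_lebesgue_integral_eq_integral(1))
      show "g integrable_on {t - h..t + h}"
        using g by (simp add: set_lebesgue_integral_eq_integral(1))
      fix s
      have "d / (d\<^sup>2 + (s - t)\<^sup>2) \<le> d / d\<^sup>2"
        using \<open>0 < d\<close> by (intro divide_left_mono mult_pos_pos add_pos_nonneg) auto
      also have "\<dots> = 1 / d" by (simp add: power2_eq_square)
      finally show "d / (d\<^sup>2 + (s - t)\<^sup>2) * g s \<le> 1 / d * g s"
        by (intro mult_right_mono nonneg)
    qed
    also have "\<dots> = 1 / d * integral {t - h..t + h} g"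
      by simp
    also have "\<dots> \<le> 1 / d * (e * h)"
      using avg[of h] \<open>0 < d\<close> h by (intro mult_left_mono) auto
    also have "\<dots> = h / d * e" by simp
    also have "\<dots> \<le> (6 - 4 * d / h) * e"
    proof (rule mult_right_mono[OF _ \<open>e \<ge> 0\<close>])
      have "h / d \<le> 2" "d / h \<le> 1" using h \<open>0 < d\<close> by (simp_all add: field_simps)
      thus "h / d \<le> 6 - 4 * d / h" by simp
    qed
    finally show ?thesis .
  qed
  have "h \<le> 2 ^ n * d \<Longrightarrow> d \<le> h \<Longrightarrow> h \<le> r \<Longrightarrow> ?J h \<le> (6 - 4 * d / h) * e" for n h
  proof (induction n arbitrary: h)
    case 0
    thus ?case using small[of h] \<open>0 < d\<close> by simp
  next
    case (Suc n)
    show ?case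
    proof (cases "h \<le> 2 * d")
      case True
      thus ?thesis using small Suc.prems by blast
    next
      case False
      hence "h > 0" using \<open>0 < d\<close> by simp
      have "?J h \<le> ?J (h / 2) + d / (h / 2)\<^sup>2 * integral {t - h..t + h} g"
        using False \<open>0 < d\<close> by (intro cauchy_weight_integral_split g nonneg) auto
      also have "\<dots> \<le> (6 - 4 * d / (h / 2)) * e + d / (h / 2)\<^sup>2 * (e * h)"
        using Suc.prems False avg[of h] \<open>0 < d\<close>
        by (intro add_mono mult_left_mono Suc.IH) auto
      also have "\<dots> = (6 - 4 * d / h) * e"
        using \<open>h > 0\<close> by (simp add: field_simps power2_eq_square)
      finally show ?thesis .
    qed
  qed
  moreover obtain n where "h / d < 2 ^ n"
    using real_arch_pow[of 2 "h / d"] by auto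
  hence "h \<le> 2 ^ n * d" using \<open>0 < d\<close> by (simp add: field_simps)
  ultimately show ?thesis using assms by blast
qed

text \<open>
  As \<open>K\<close> has mean one, \<open>f t\<close> is the mean of \<open>s \<mapsto> K (t - s) * f t\<close>, and can be subtracted under the
  integral.
\<close>

lemma circle_conv_minus_bound:
  assumes K: "peaked_kernel C d K" and f: "f \<in> L1_circle"
  shows "norm (circle_conv K f t - f t)
    \<le> C / (2 * pi) * integral {t - pi..t + pi} (\<lambda>s. d / (d\<^sup>2 + (s - t)\<^sup>2) * norm (f s - f t))"
proof -
  define I where "I = {t - pi..t - pi + 2 * pi}"
  have I: "I = {t - pi..t + pi}" by (simp add: I_def)
  from K have C: "C \<ge> 0" "d > 0" and per: "periodic_2pi K" and meas: "K \<in> borel_measurable borel"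
    and mean: "circle_mean K = 1" and bnd: "\<And>s. s \<in> {-pi..pi} \<Longrightarrow> norm (K s) \<le> C * (d / (d\<^sup>2 + s\<^sup>2))"
    by (auto simp: peaked_kernel_def)
  have fper: "periodic_2pi f" using f by (simp add: L1_circle_def)
  have fint: "f absolutely_integrable_on {a..b}" for a b
    by (rule L1_circle_absolutely_integrable[OF f])
  have perK: "K (x - (y + 2 * pi)) = K (x - y)" for x y
    using per[unfolded periodic_2pi_def, rule_format, of "x - (y + 2 * pi)"] by (simp add: algebra_simps)
  have bnd': "norm (K (t - s)) \<le> C * (d / (d\<^sup>2 + (s - t)\<^sup>2))" if "s \<in> I" for s
    using bnd[of "t - s"] that by (auto simp: I power2_commute)
  have bounded: "bounded ((\<lambda>s. K (t - s)) ` I)"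
  proof (intro boundedI)
    fix x assume "x \<in> (\<lambda>s. K (t - s)) ` I"
    then obtain s where s: "s \<in> I" "x = K (t - s)" by blast
    have "norm x \<le> C * (d / (d\<^sup>2 + (s - t)\<^sup>2))" using bnd' s by simp
    also have "\<dots> \<le> C * (d / d\<^sup>2)"
      using C by (intro divide_left_mono mult_left_mono mult_pos_pos add_pos_nonneg) auto
    finally show "norm x \<le> C * (d / d\<^sup>2)" .
  qed
  have meas': "(\<lambda>s. K (t - s)) \<in> borel_measurable (lebesgue_on I)"
    by (intro measurable_restrict_space1 measurable_completion) (use meas in measurable)
  have mult_int: "(\<lambda>s. K (t - s) * g s) absolutely_integrable_on I"
    if "g absolutely_integrable_on I" for g
    by (rule absolutely_integrable_bounded_measurable_product[OF bilinear_times meas' _ bounded that])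
       (simp add: I)
  have Kint: "(\<lambda>s. K (t - s)) absolutely_integrable_on I"
    using mult_int[of "\<lambda>_. 1"] by (simp add: I)
  have Kfint: "(\<lambda>s. K (t - s) * f s) absolutely_integrable_on I"
    using mult_int[of f] fint by (simp add: I)
  have conv: "circle_conv K f t = complex_of_real (1 / (2 * pi)) * integral I (\<lambda>s. K (t - s) * f s)"
    unfolding circle_conv_def I_def
    by (rule circle_mean_eq_integral)
       (use Kfint fper perK in \<open>auto simp: I_def periodic_2pi_def\<close>)
  have "integral I (\<lambda>s. K (t - s)) = integral {-pi..pi} (\<lambda>s. K (- s))"
    using integral_shift_Icc_real[of "\<lambda>s. K (t - s)" "-pi" t pi] Kint
    by (simp add: I algebra_simps set_lebesgue_integral_eq_integral(1))
  also have "\<dots> = integral {-pi..pi} K"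
    using Henstock_Kurzweil_Integration.integral_reflect_real[of pi "-pi" K] by simp
  finally have "integral I (\<lambda>s. K (t - s)) = integral {-pi..-pi + 2 * pi} K"
    by simp
  moreover have "K absolutely_integrable_on {-pi..pi}"
  proof (rule measurable_bounded_by_integrable_imp_absolutely_integrable)
    show "K \<in> borel_measurable (lebesgue_on {-pi..pi})"
      by (intro measurable_restrict_space1 measurable_completion) (use meas in measurable)
    fix s assume "s \<in> {-pi..pi}"
    hence "norm (K s) \<le> C * (d / (d\<^sup>2 + s\<^sup>2))" by (rule bnd)
    also have "\<dots> \<le> C * (d / d\<^sup>2)"
      using C by (intro divide_left_mono mult_left_mono mult_pos_pos add_pos_nonneg) auto
    finally show "norm (K s) \<le> C * (d / d\<^sup>2)" .
  qed auto
  ultimately have Kmean: "complex_of_real (1 / (2 * pi)) * integral I (\<lambda>s. K (t - s)) = 1"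
    using circle_mean_eq_integral[OF per, of "-pi"] mean by simp
  have diff_int: "(\<lambda>s. norm (f s - f t)) absolutely_integrable_on {a..b}" for a b
    by (rule absolutely_integrable_norm_diff_const[OF fint])
  have "circle_conv K f t - f t = complex_of_real (1 / (2 * pi)) *
      (integral I (\<lambda>s. K (t - s) * f s) - integral I (\<lambda>s. K (t - s)) * f t)"
    unfolding conv right_diff_distrib mult.assoc[symmetric] Kmean by simp
  also have "integral I (\<lambda>s. K (t - s) * f s) - integral I (\<lambda>s. K (t - s)) * f t =
      integral I (\<lambda>s. K (t - s) * (f s - f t))"
    using Kint Kfint
    by (simp add: right_diff_distrib Henstock_Kurzweil_Integration.integral_diff
        set_lebesgue_integral_eq_integral(1) integrable_on_mult_left)
  finally have "norm (circle_conv K f t - f t) =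
      1 / (2 * pi) * norm (integral I (\<lambda>s. K (t - s) * (f s - f t)))"
    by (simp add: norm_mult norm_divide)
  also have "norm (integral I (\<lambda>s. K (t - s) * (f s - f t)))
      \<le> integral I (\<lambda>s. C * (d / (d\<^sup>2 + (s - t)\<^sup>2) * norm (f s - f t)))"
  proof (rule Henstock_Kurzweil_Integration.integral_norm_bound_integral)
    show "(\<lambda>s. K (t - s) * (f s - f t)) integrable_on I"
      using mult_int[of "\<lambda>s. f s - f t"] set_integral_diff(1)[OF fint absolutely_integrable_on_const[of _ "f t"]]
      by (simp add: I set_lebesgue_integral_eq_integral(1))
    show "(\<lambda>s. C * (d / (d\<^sup>2 + (s - t)\<^sup>2) * norm (f s - f t))) integrable_on I"
      using cauchy_weight_mult_absolutely_integrable[OF diff_int \<open>d > 0\<close>]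
      by (intro integrable_on_mult_right) (simp add: I set_lebesgue_integral_eq_integral(1))
    fix s assume "s \<in> I"
    have "norm (K (t - s)) * norm (f s - f t) \<le> C * (d / (d\<^sup>2 + (s - t)\<^sup>2)) * norm (f s - f t)"
      by (intro mult_right_mono bnd' \<open>s \<in> I\<close>) auto
    thus "norm (K (t - s) * (f s - f t)) \<le> C * (d / (d\<^sup>2 + (s - t)\<^sup>2) * norm (f s - f t))"
      by (simp only: norm_mult mult.assoc)
  qed
  also have "integral I (\<lambda>s. C * (d / (d\<^sup>2 + (s - t)\<^sup>2) * norm (f s - f t))) =
      C * integral I (\<lambda>s. d / (d\<^sup>2 + (s - t)\<^sup>2) * norm (f s - f t))"
    by (rule Henstock_Kurzweil_Integration.integral_mult_right)
  finally show ?thesis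
    by (simp add: I mult_left_mono divide_right_mono)
qed

lemma circle_conv_tendsto_at_lebesgue_point:
  assumes f: "f \<in> L1_circle" and t: "lebesgue_point f t"
    and K: "\<forall>\<^sub>F i in F. peaked_kernel C (d i) (K i)" and d: "(d \<longlongrightarrow> 0) F"
  shows "((\<lambda>i. circle_conv (K i) f t) \<longlongrightarrow> f t) F"
proof (cases "F = bot")
  case False
  define g where "g = (\<lambda>s. norm (f s - f t))"
  have g: "g absolutely_integrable_on {a..b}" for a b
    unfolding g_def by (intro absolutely_integrable_norm_diff_const L1_circle_absolutely_integrable f)
  have g0: "g s \<ge> 0" for s by (simp add: g_def)
  obtain i where "peaked_kernel C (d i) (K i)"
    using eventually_happens[OF K] False by auto
  hence C: "C \<ge> 0" by (simp add: peaked_kernel_def)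
  show ?thesis
  proof (rule tendstoI)
    fix \<epsilon> :: real assume \<epsilon>: "\<epsilon> > 0"
    \<comment> \<open>The part near \<open>t\<close> contributes at most \<open>6 C e / (2\<pi>)\<close>, hence at most \<open>C e\<close>; \<open>C + 1\<close> avoids division by zero.\<close>
    define e where "e = \<epsilon> / (2 * (C + 1))"
    have e: "e > 0" using \<epsilon> C by (simp add: e_def)
    obtain \<delta> where \<delta>: "\<delta> > 0" "\<And>h. \<lbrakk>0 < h; h < \<delta>\<rbrakk> \<Longrightarrow> integral {t - h..t + h} g \<le> e * h"
      using t e unfolding lebesgue_point_def g_def by meson
    define r where "r = min (\<delta> / 2) pi"
    have r: "r > 0" "r \<le> pi" "r < \<delta>" using \<delta>(1) by (auto simp: r_def)
    define M where "M = integral {t - pi..t + pi} g"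
    have "((\<lambda>i. C / (2 * pi) * (d i / r\<^sup>2 * M)) \<longlongrightarrow> C / (2 * pi) * (0 / r\<^sup>2 * M)) F"
      by (intro tendsto_intros d) (use r in auto)
    hence tail: "\<forall>\<^sub>F i in F. C / (2 * pi) * (d i / r\<^sup>2 * M) < \<epsilon> / 2"
      by (rule order_tendstoD) (use \<epsilon> in auto)
    have small: "\<forall>\<^sub>F i in F. d i < r"
      using d r by (intro order_tendstoD)
    show "\<forall>\<^sub>F i in F. dist (circle_conv (K i) f t) (f t) < \<epsilon>"
      using K tail small
    proof eventually_elim
      case (elim i)
      have di: "d i > 0" using elim(1) by (simp add: peaked_kernel_def)
      let ?J = "\<lambda>h. integral {t - h..t + h} (\<lambda>s. d i / ((d i)\<^sup>2 + (s - t)\<^sup>2) * g s)"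
      have "?J pi \<le> ?J r + d i / r\<^sup>2 * M"
        unfolding M_def by (intro cauchy_weight_integral_split g g0 di r)
      also have "?J r \<le> (6 - 4 * d i / r) * e"
        by (rule cauchy_weight_integral_le[where r = r]) (use g g0 e di elim \<delta> r in auto)
      also have "\<dots> \<le> 6 * e"
        using di r e by (intro mult_right_mono) auto
      finally have J: "?J pi \<le> 6 * e + d i / r\<^sup>2 * M" by simp
      have "dist (circle_conv (K i) f t) (f t) \<le> C / (2 * pi) * ?J pi"
        using circle_conv_minus_bound[OF elim(1) f] by (simp add: g_def dist_norm)
      also have "\<dots> \<le> C / (2 * pi) * (6 * e + d i / r\<^sup>2 * M)"
        using J C by (intro mult_left_mono) auto
      also have "\<dots> = 6 / (2 * pi) * (C * e) + C / (2 * pi) * (d i / r\<^sup>2 * M)"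
        by (simp add: field_simps)
      also have "6 / (2 * pi) * (C * e) \<le> 1 * (C * e)"
        using pi_gt3 C e by (intro mult_right_mono) auto
      also have "1 * (C * e) \<le> \<epsilon> / 2"
        using C \<epsilon> by (simp add: e_def field_simps)
      finally show ?case using elim(2) by linarith
    qed
  qed
qed simp

section \<open>The Fejer, Poisson and Lebesgue kernels\<close>

lemma cis_int_mult_periodic: "cis (of_int j * (t + 2 * pi)) = cis (of_int j * t)"
proof -
  have "cis (of_int j * (t + 2 * pi)) = cis (of_int j * t) * cis (2 * pi * of_int j)"
    by (simp only: cis_mult distrib_left mult.commute)
  thus ?thesis by (simp del: cis_mult)
qed

lemma circle_mean_cmult: "circle_mean (\<lambda>t. c * g t) = c * circle_mean g"
  by (simp add: circle_mean_def)

lemma circle_mean_add: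
  assumes "f absolutely_integrable_on {-pi..pi}" "g absolutely_integrable_on {-pi..pi}"
  shows "circle_mean (\<lambda>t. f t + g t) = circle_mean f + circle_mean g"
  using set_integral_add(2)[OF assms] by (simp add: circle_mean_def distrib_left)

lemma circle_mean_sum:
  assumes "finite A" "\<And>j. j \<in> A \<Longrightarrow> g j absolutely_integrable_on {-pi..pi}"
  shows "circle_mean (\<lambda>t. \<Sum>j\<in>A. g j t) = (\<Sum>j\<in>A. circle_mean (g j))"
  using assms
proof (induction A)
  case empty
  show ?case by (simp add: circle_mean_def)
next
  case (insert j A)
  hence "(\<lambda>t. \<Sum>j\<in>A. g j t) absolutely_integrable_on {-pi..pi}"
    by (intro absolutely_integrable_sum) auto
  thus ?case using insert by (simp add: circle_mean_add)
qed

lemma circle_mean_cis: "circle_mean (\<lambda>t. cis (of_int j * t)) = (if j = 0 then 1 else 0)"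
proof -
  have "(\<lambda>t. cis (of_int j * t)) absolutely_integrable_on {-pi..pi}"
    by (intro absolutely_integrable_continuous_real continuous_intros)
  hence mean: "circle_mean (\<lambda>t. cis (of_int j * t)) =
      complex_of_real (1 / (2 * pi)) * integral {-pi..pi} (\<lambda>t. cis (of_int j * t))"
    by (simp add: circle_mean_def set_lebesgue_integral_eq_integral(2))
  show ?thesis
  proof (cases "j = 0")
    case True
    thus ?thesis unfolding mean by (simp add: scaleR_conv_of_real)
  next
    case False
    let ?F = "\<lambda>t::real. exp (\<i> * of_int j * of_real t) / (\<i> * of_int j)"
    have "((\<lambda>t. cis (of_int j * t)) has_integral (?F pi - ?F (-pi))) {-pi..pi}"
    proof (rule fundamental_theorem_of_calculus)
      fix x :: real
      have "((\<lambda>z. exp (\<i> * of_int j * z) / (\<i> * of_int j)) has_field_derivative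
          exp (\<i> * of_int j * of_real x)) (at (of_real x))"
        using False by (auto intro!: derivative_eq_intros)
      thus "(?F has_vector_derivative cis (of_int j * x)) (at x within {-pi..pi})"
        by (intro has_vector_derivative_real_field) (simp add: cis_conv_exp mult.assoc)
    qed simp
    moreover have "?F pi = ?F (- pi)"
      using cis_int_mult_periodic[of j "- pi"] by (simp add: cis_conv_exp mult.assoc)
    ultimately show ?thesis using False unfolding mean by (simp add: integral_unique)
  qed
qed

text \<open>
  The constant comes from \<open>sin x \<ge> x / 3\<close> on \<open>[0, 2]\<close>, a consequence of \<open>\<bar>sin x - x\<bar> \<le> x\<^sup>3 / 6\<close>, and
  \<open>1 - cos s = 2 (sin (s / 2))\<^sup>2\<close>.
\<close>

lemma one_minus_cos_ge:
  assumes "s \<in> {-pi..pi}"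
  shows "s\<^sup>2 / 18 \<le> 1 - cos s"
proof -
  define x where "x = \<bar>s\<bar> / 2"
  have x: "0 \<le> x" "x \<le> 2" using assms pi_less_4 by (auto simp: x_def)
  have "\<bar>sin x - x\<bar> \<le> x ^ 3 / 6"
    using Maclaurin_sin_bound[of x 3] x by (simp add: sin_coeff_def eval_nat_numeral)
  moreover have "x ^ 3 \<le> 4 * x"
  proof -
    have "x\<^sup>2 \<le> 2\<^sup>2" using x by (intro power_mono)
    hence "x\<^sup>2 * x \<le> 4 * x" using x by (intro mult_right_mono) auto
    thus ?thesis by (simp add: power3_eq_cube power2_eq_square)
  qed
  ultimately have "x / 3 \<le> sin x" by linarith
  hence "(x / 3)\<^sup>2 \<le> (sin x)\<^sup>2" using x by (intro power_mono) auto
  moreover have "cos s = 1 - 2 * (sin x)\<^sup>2"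
    using cos_double_sin[of x] by (simp add: x_def)
  moreover have "2 * (x / 3)\<^sup>2 = s\<^sup>2 / 18"
    by (simp add: x_def power_divide)
  ultimately show ?thesis by linarith
qed

text \<open>
  It suffices to bound the height and the tails of a kernel separately.
\<close>

lemma cauchy_weight_bound:
  fixes x :: real
  assumes "d > 0" "x \<le> A / d" "s\<^sup>2 * x \<le> B * d"
  shows "x \<le> (A + B) * (d / (d\<^sup>2 + s\<^sup>2))"
proof -
  have "d\<^sup>2 * x \<le> d\<^sup>2 * (A / d)"
    using assms by (intro mult_left_mono) auto
  also have "\<dots> = A * d"
    using assms by (simp add: power2_eq_square)
  finally have "(d\<^sup>2 + s\<^sup>2) * x \<le> (A + B) * d"
    using assms by (simp add: algebra_simps)
  moreover have "d\<^sup>2 + s\<^sup>2 > 0" using assms by (simp add: add_pos_nonneg)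
  ultimately show ?thesis by (simp add: field_simps)
qed

lemma sum_symmetric_interval_Suc:
  fixes a :: "int \<Rightarrow> complex"
  shows "(\<Sum>j = - int (Suc n)..int (Suc n). a j) =
    (\<Sum>j = - int n..int n. a j) + a (int (Suc n)) + a (- int (Suc n))"
proof -
  have "{- int (Suc n)..int (Suc n)} = insert (int (Suc n)) (insert (- int (Suc n)) {- int n..int n})"
    by auto
  thus ?thesis by simp
qed

text \<open>
  The term \<open>a j\<close> occurs in the partial sums with index \<open>\<bar>j\<bar>, \<dots>, n\<close>.
\<close>

lemma sum_symmetric_partial_sums:
  fixes a :: "int \<Rightarrow> complex"
  shows "(\<Sum>k\<le>n. \<Sum>j = - int k..int k. a j) =
    (\<Sum>j = - int n..int n. (of_nat (n + 1) - of_int \<bar>j\<bar>) * a j)"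
proof (induction n)
  case (Suc n)
  have "(\<Sum>j = - int (Suc n)..int (Suc n). (of_nat (Suc n + 1) - of_int \<bar>j\<bar>) * a j) =
      (\<Sum>j = - int n..int n. (of_nat (Suc n + 1) - of_int \<bar>j\<bar>) * a j) + a (int (Suc n)) + a (- int (Suc n))"
    unfolding sum_symmetric_interval_Suc by simp
  also have "(\<Sum>j = - int n..int n. (of_nat (Suc n + 1) - of_int \<bar>j\<bar>) * a j) =
      (\<Sum>j = - int n..int n. (of_nat (n + 1) - of_int \<bar>j\<bar>) * a j) + (\<Sum>j = - int n..int n. a j)"
    by (simp add: sum.distrib[symmetric] algebra_simps)
  finally show ?case using Suc by (simp add: sum_symmetric_interval_Suc del: of_nat_Suc)
qed simp

lemma fejer_weight_mult:
  "complex_of_real (1 - of_int \<bar>j\<bar> / of_nat (n + 1)) * x =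
    ((of_nat (n + 1) - of_int \<bar>j\<bar>) * x) / of_nat (n + 1)"
proof -
  have nz: "complex_of_nat (n + 1) \<noteq> 0" by (simp only: of_nat_eq_0_iff)
  have "complex_of_real (1 - of_int \<bar>j\<bar> / of_nat (n + 1)) = (of_nat (n + 1) - of_int \<bar>j\<bar>) / of_nat (n + 1)"
    by (simp only: of_real_diff of_real_divide of_real_of_int_eq of_real_of_nat_eq of_real_1
        diff_divide_distrib divide_self[OF nz])
  thus ?thesis by (simp only: times_divide_eq_left)
qed

lemma fejer_kernel_eq_dirichlet_mean:
  "fejer_kernel n t = (\<Sum>k\<le>n. \<Sum>j = - int k..int k. cis (of_int j * t)) / of_nat (n + 1)"
  unfolding fejer_kernel_def sum_symmetric_partial_sums fejer_weight_mult sum_divide_distrib ..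

lemma cesaro_mean_eq_fejer_conv:
  assumes "f \<in> L1_circle"
  shows "cesaro_mean n f = circle_conv (fejer_kernel n) f"
proof
  fix t
  let ?c = "\<lambda>j. complex_of_real (1 - of_int \<bar>j\<bar> / of_nat (n + 1))"
  have f: "f absolutely_integrable_on {-pi..pi}" using assms by (simp add: L1_circle_def)
  have int: "(\<lambda>\<tau>. cis (- (of_int j * \<tau>)) * f \<tau>) absolutely_integrable_on {-pi..pi}" for j
    by (rule absolutely_integrable_bounded_measurable_product[OF bilinear_times _ _ _ f])
       (auto intro!: continuous_imp_measurable_on_sets_lebesgue continuous_intros boundedI[of _ 1])
  have split: "?c j * cis (of_int j * (t - \<tau>)) * f \<tau> =
      (?c j * cis (of_int j * t)) * (cis (- (of_int j * \<tau>)) * f \<tau>)" for j \<tau>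
  proof -
    have "cis (of_int j * (t - \<tau>)) = cis (of_int j * t) * cis (- (of_int j * \<tau>))"
      unfolding cis_mult by (simp add: algebra_simps)
    thus ?thesis by simp
  qed
  have "circle_conv (fejer_kernel n) f t =
      circle_mean (\<lambda>\<tau>. \<Sum>j = - int n..int n. (?c j * cis (of_int j * t)) * (cis (- (of_int j * \<tau>)) * f \<tau>))"
    unfolding circle_conv_def fejer_kernel_def sum_distrib_right split ..
  also have "\<dots> = (\<Sum>j = - int n..int n. ?c j * cis (of_int j * t) * circle_mean (\<lambda>\<tau>. cis (- (of_int j * \<tau>)) * f \<tau>))"
    by (subst circle_mean_sum) (auto intro!: set_integrable_mult_right int simp: circle_mean_cmult)
  also have "\<dots> = (\<Sum>j = - int n..int n. ?c j * (fourier_coeff f j * cis (of_int j * t)))"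
    by (simp add: fourier_coeff_def mult_ac)
  also have "\<dots> = cesaro_mean n f t"
    unfolding cesaro_mean_def fourier_partial_sum_def sum_symmetric_partial_sums
      fejer_weight_mult sum_divide_distrib ..
  finally show "cesaro_mean n f t = circle_conv (fejer_kernel n) f t" ..
qed

lemma dirichlet_kernel_times:
  "(\<Sum>j = - int k..int k. cis (of_int j * t)) * complex_of_real (2 - 2 * cos t) =
    complex_of_real (2 * cos (real k * t) - 2 * cos (real (Suc k) * t))"
proof (induction k)
  case (Suc k)
  let ?x = "real (Suc k) * t"
  have two: "cis (of_int (int (Suc k)) * t) + cis (of_int (- int (Suc k)) * t) = complex_of_real (2 * cos ?x)"
  proof -
    have "of_int (- int (Suc k)) * t = - ?x" "of_int (int (Suc k)) * t = ?x" by (simp_all add: algebra_simps)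
    thus ?thesis by (simp only: complex_eq_iff) simp
  qed
  have "real k * t = ?x - t" "real (Suc (Suc k)) * t = ?x + t" by (simp_all add: algebra_simps)
  hence trig: "2 * cos (real k * t) - 2 * cos ?x + 2 * cos ?x * (2 - 2 * cos t) =
      2 * cos ?x - 2 * cos (real (Suc (Suc k)) * t)"
    by (simp only: cos_add cos_diff) (simp add: algebra_simps)
  have "(\<Sum>j = - int (Suc k)..int (Suc k). cis (of_int j * t)) * complex_of_real (2 - 2 * cos t) =
      (\<Sum>j = - int k..int k. cis (of_int j * t)) * complex_of_real (2 - 2 * cos t) +
      complex_of_real (2 * cos ?x) * complex_of_real (2 - 2 * cos t)"
    unfolding sum_symmetric_interval_Suc two[symmetric] by (simp add: algebra_simps)
  also have "\<dots> = complex_of_real (2 * cos ?x - 2 * cos (real (Suc (Suc k)) * t))"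
    unfolding Suc trig[symmetric] by simp
  finally show ?case .
qed simp

text \<open>
  The factor \<open>2 - 2 cos t\<close> turns the sum of the Dirichlet kernels into a telescoping one. In closed
  form, \<open>F\<^sub>n(t) = (1 - cos ((n + 1) t)) / ((n + 1) (1 - cos t))\<close>; the product form
  also covers the zeros of the denominator.
\<close>

lemma fejer_kernel_times:
  "fejer_kernel n t * complex_of_real (2 - 2 * cos t) =
    complex_of_real ((2 - 2 * cos (real (Suc n) * t)) / (real n + 1))"
proof -
  have "(\<Sum>k\<le>n. \<Sum>j = - int k..int k. cis (of_int j * t)) * complex_of_real (2 - 2 * cos t) =
      complex_of_real (\<Sum>k\<le>n. 2 * cos (real k * t) - 2 * cos (real (Suc k) * t))"
    by (subst sum_distrib_right) (simp only: dirichlet_kernel_times of_real_sum)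
  also have "(\<Sum>k\<le>n. 2 * cos (real k * t) - 2 * cos (real (Suc k) * t)) = 2 - 2 * cos (real (Suc n) * t)"
    by (induction n) auto
  finally show ?thesis unfolding fejer_kernel_eq_dirichlet_mean by simp
qed

text \<open>
  The height of the kernel is at most its number \<open>2n + 1\<close> of terms, and the product formula gives the
  tail bound \<open>36 / ((n + 1) s\<^sup>2)\<close>; hence \<open>38 = 2 + 36\<close>.
\<close>

lemma peaked_kernel_fejer: "peaked_kernel 38 (1 / (real n + 1)) (fejer_kernel n)"
  unfolding peaked_kernel_def
proof (intro conjI ballI)
  let ?d = "1 / (real n + 1)"
  show d: "?d > 0" by simp
  show "periodic_2pi (fejer_kernel n)"
    unfolding periodic_2pi_def fejer_kernel_def
by (simp only: cis_int_mult_periodic) simp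
  show "fejer_kernel n \<in> borel_measurable borel"
    unfolding fejer_kernel_def by (intro borel_measurable_continuous_onI continuous_intros)
  show "circle_mean (fejer_kernel n) = 1"
  proof -
    have "circle_mean (fejer_kernel n) = (\<Sum>j = - int n..int n.
        complex_of_real (1 - of_int \<bar>j\<bar> / of_nat (n + 1)) * (if j = 0 then 1 else 0))"
      unfolding fejer_kernel_def
      by (subst circle_mean_sum)
         (auto simp: circle_mean_cmult circle_mean_cis
           intro!: absolutely_integrable_continuous_real continuous_intros)
    also have "\<dots> = 1" by (simp add: if_distrib[of "(*) _"] cong: if_cong)
    finally show ?thesis .
  qed
  fix s assume s: "s \<in> {-pi..pi}"
  have "norm (fejer_kernel n s) \<le> 2 / ?d"
  proof -
    have "norm (fejer_kernel n s) \<le> (\<Sum>j = - int n..int n. 1)"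
      unfolding fejer_kernel_def
    proof (rule sum_norm_le)
      fix j assume "j \<in> {- int n..int n}"
      hence "of_int \<bar>j\<bar> \<le> (of_int (int n) :: real)" by (subst of_int_le_iff) auto
      hence "\<bar>1 - of_int \<bar>j\<bar> / real (n + 1)\<bar> \<le> 1"
        by (simp add: abs_le_iff field_simps)
      thus "norm (complex_of_real (1 - of_int \<bar>j\<bar> / of_nat (n + 1)) * cis (of_int j * s)) \<le> 1"
        by (simp only: norm_mult norm_of_real norm_cis mult_1_right)
    qed
    thus ?thesis by simp
  qed
  moreover have "s\<^sup>2 * norm (fejer_kernel n s) \<le> 36 * ?d"
  proof -
    have "s\<^sup>2 * norm (fejer_kernel n s) \<le> 9 * ((2 - 2 * cos s) * norm (fejer_kernel n s))"
      using one_minus_cos_ge[OF s] unfolding mult.assoc[symmetric] by (intro mult_right_mono) auto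
    also have "(2 - 2 * cos s) * norm (fejer_kernel n s) = norm (fejer_kernel n s * complex_of_real (2 - 2 * cos s))"
      by (simp only: norm_mult norm_of_real) simp
    also have "\<dots> = \<bar>2 - 2 * cos (real (Suc n) * s)\<bar> / (real n + 1)"
      unfolding fejer_kernel_times norm_of_real by simp
    also have "\<dots> \<le> 4 / (real n + 1)"
      using cos_ge_minus_one[of "real (Suc n) * s"] cos_le_one[of "real (Suc n) * s"]
      by (intro divide_right_mono) linarith+
    finally show ?thesis by simp
  qed
  ultimately show "norm (fejer_kernel n s) \<le> 38 * (?d / (?d\<^sup>2 + s\<^sup>2))"
    using cauchy_weight_bound[OF d, of _ 2 s 36] by fastforce
qed simp


text \<open>
  With \<open>z = r * cis t\<close> the Poisson kernel is \<open>1 + w + cnj w\<close>, where \<open>w = z / (1 - z)\<close>. As \<open>w - z w = z\<close>, the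
  means of \<open>z\<^sup>n w\<close> do not depend on \<open>n\<close>; they tend to zero.
\<close>

lemma circle_mean_geometric:
  assumes r: "0 < r" "r < 1"
  shows "circle_mean (\<lambda>t. of_real r * cis t / (1 - of_real r * cis t)) = 0"
proof -
  define z where "z = (\<lambda>t. of_real r * cis t)"
  define w where "w = (\<lambda>t. z t / (1 - z t))"
  have nz: "norm (z t) = r" for t using r by (simp add: z_def norm_mult)
  have ne: "1 - z t \<noteq> 0" for t using nz[of t] r by auto
  have cz: "continuous_on A z" for A unfolding z_def by (intro continuous_intros)
  have cw: "continuous_on A w" for A unfolding w_def by (intro continuous_intros cz) (use ne in auto)
  have step: "circle_mean (\<lambda>t. z t ^ n * w t) = circle_mean (\<lambda>t. z t ^ Suc n * w t)" for n
  proof -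
    have "z t ^ n * w t = z t ^ Suc n + z t ^ Suc n * w t" for t
    proof -
      have "w t = z t + z t * w t" using ne[of t] by (simp add: w_def field_simps)
      thus ?thesis by (metis distrib_left mult.assoc mult.commute power_Suc)
    qed
    hence "circle_mean (\<lambda>t. z t ^ n * w t) =
        circle_mean (\<lambda>t. z t ^ Suc n) + circle_mean (\<lambda>t. z t ^ Suc n * w t)"
      by (subst circle_mean_add[symmetric])
         (auto intro!: absolutely_integrable_continuous_real continuous_intros cz cw simp del: power_Suc)
    also have "circle_mean (\<lambda>t. z t ^ Suc n) = of_real r ^ Suc n * circle_mean (\<lambda>t. cis (of_int (int (Suc n)) * t))"
      unfolding z_def power_mult_distrib circle_mean_cmult Complex.DeMoivre by simp
    also have "\<dots> = 0" unfolding circle_mean_cis by simp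
    finally show ?thesis by simp
  qed
  have const: "circle_mean (\<lambda>t. z t ^ n * w t) = circle_mean w" for n
    by (induction n) (simp_all add: step[symmetric] del: power_Suc)
  have bound: "norm (circle_mean w) \<le> r ^ n * (1 / (1 - r))" for n
  proof -
    have int: "(\<lambda>t. z t ^ n * w t) absolutely_integrable_on {-pi..pi}"
      by (intro absolutely_integrable_continuous_real continuous_intros cz cw)
    have "norm (integral {-pi..pi} (\<lambda>t. z t ^ n * w t)) \<le> integral {-pi..pi} (\<lambda>t. r ^ n * (1 / (1 - r)))"
    proof (rule Henstock_Kurzweil_Integration.integral_norm_bound_integral)
      show "(\<lambda>t. z t ^ n * w t) integrable_on {-pi..pi}"
        using int by (simp add: set_lebesgue_integral_eq_integral(1))
      fix t
      have "1 - r \<le> norm (1 - z t)" using norm_triangle_ineq2[of 1 "z t"] nz[of t] by simp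
      hence "norm (w t) \<le> 1 / (1 - r)"
        unfolding w_def norm_divide nz using r by (intro frac_le) auto
      thus "norm (z t ^ n * w t) \<le> r ^ n * (1 / (1 - r))"
        unfolding norm_mult norm_power nz using r by (intro mult_left_mono) auto
    qed auto
    hence "norm (integral {-pi..pi} (\<lambda>t. z t ^ n * w t)) / (2 * pi) \<le> r ^ n * (1 / (1 - r))"
      by (simp add: field_simps)
    moreover have "norm (circle_mean (\<lambda>t. z t ^ n * w t)) =
        norm (integral {-pi..pi} (\<lambda>t. z t ^ n * w t)) / (2 * pi)"
      unfolding circle_mean_def set_lebesgue_integral_eq_integral(2)[OF int]
      by (simp add: norm_mult norm_divide)
    ultimately show ?thesis by (simp only: const)
  qed
  have "(\<lambda>n. r ^ n * (1 / (1 - r))) \<longlonglongrightarrow> 0 * (1 / (1 - r))"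
    using r by (intro tendsto_intros LIMSEQ_realpow_zero) auto
  hence "norm (circle_mean w) \<le> 0"
    using bound by (intro LIMSEQ_le_const) auto
  thus ?thesis by (simp add: w_def z_def)
qed

lemma circle_mean_cnj: "circle_mean (\<lambda>t. cnj (g t)) = cnj (circle_mean g)"
proof -
  have "(LINT t:{-pi..pi}|lebesgue. cnj (g t)) = cnj (LINT t:{-pi..pi}|lebesgue. g t)"
    unfolding set_lebesgue_integral_def by (simp flip: integral_cnj complex_cnj_scaleR)
  thus ?thesis by (simp add: circle_mean_def)
qed

lemma poisson_kernel_eq_geometric:
  assumes r: "0 < r" "r < 1"
  defines "w \<equiv> \<lambda>t. of_real r * cis t / (1 - of_real r * cis t)"
  shows "poisson_kernel r t = 1 + (w t + cnj (w t))"
proof -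
  define z where "z = of_real r * cis t"
  have nz: "norm z = r" using r by (simp add: z_def norm_mult)
  hence "norm z < 1" "norm (cnj z) < 1" using r by simp_all
  hence ne: "1 - z \<noteq> 0" "1 - cnj z \<noteq> 0" by auto
  have zz: "z * cnj z = of_real (r\<^sup>2)" using complex_norm_square[of z] nz by simp
  have zs: "z + cnj z = of_real (2 * r * cos t)" using complex_add_cnj[of z] by (simp add: z_def)
  have "1 + (z / (1 - z) + cnj z / (1 - cnj z)) = (1 - z * cnj z) / (1 - (z + cnj z) + z * cnj z)"
  proof -
    have factor: "1 - (z + cnj z) + z * cnj z = (1 - z) * (1 - cnj z)" by (simp add: algebra_simps)
    show ?thesis unfolding factor using ne by (simp add: divide_simps) (simp add: algebra_simps)
  qed
  also have "\<dots> = poisson_kernel r t"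
    unfolding zz zs poisson_kernel_closed_form[OF r] by simp
  finally show ?thesis by (simp add: w_def z_def)
qed

text \<open>
  The denominator is \<open>(1 - r)\<^sup>2 + 2 r (1 - cos s)\<close>, and for \<open>r \<ge> 1 / 2\<close> its second summand is at least
  \<open>1 - cos s\<close>.
\<close>

lemma peaked_kernel_poisson:
  assumes r: "1 / 2 \<le> r" "r < 1"
  shows "peaked_kernel 36 (1 - r) (poisson_kernel r)"
  unfolding peaked_kernel_def
proof (intro conjI ballI)
  have r0: "0 < r" using r by simp
  have den: "1 - 2 * r * cos t + r\<^sup>2 = (1 - r)\<^sup>2 + 2 * r * (1 - cos t)" for t
    by (simp add: power2_eq_square algebra_simps)
  have pos: "1 - 2 * r * cos t + r\<^sup>2 > 0" for t
    unfolding den using r by (intro add_pos_nonneg) auto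
  have closed: "poisson_kernel r = (\<lambda>t. complex_of_real ((1 - r\<^sup>2) / (1 - 2 * r * cos t + r\<^sup>2)))"
    using poisson_kernel_closed_form[OF r0 r(2)] by blast
  show "periodic_2pi (poisson_kernel r)"
    by (simp add: closed periodic_2pi_def)
  show "poisson_kernel r \<in> borel_measurable borel"
    unfolding closed
    by (intro borel_measurable_continuous_onI continuous_intros) (use pos in \<open>simp add: less_imp_neq[symmetric]\<close>)
  show "circle_mean (poisson_kernel r) = 1"
  proof -
    define w where "w = (\<lambda>t. of_real r * cis t / (1 - of_real r * cis t))"
    have "1 - of_real r * cis t \<noteq> 0" for t
    proof
      assume "1 - of_real r * cis t = 0"
      hence "norm (of_real r * cis t) = norm (1::complex)" by simp
      thus False using r by (simp add: norm_mult)
    qed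
    hence w: "continuous_on {-pi..pi} w"
      unfolding w_def by (intro continuous_intros) auto
    have "circle_mean (poisson_kernel r) = circle_mean (\<lambda>t. 1 + (w t + cnj (w t)))"
      unfolding w_def using poisson_kernel_eq_geometric[OF r0 r(2)] by presburger
    also have "\<dots> = circle_mean (\<lambda>t. 1) + (circle_mean w + cnj (circle_mean w))"
      unfolding circle_mean_cnj[symmetric]
      by (subst circle_mean_add circle_mean_add;
          (intro absolutely_integrable_continuous_real continuous_intros w)?)+ simp
    also have "\<dots> = 1"
      using circle_mean_cis[of 0] circle_mean_geometric[OF r0 r(2)] by (simp add: w_def)
    finally show ?thesis .
  qed
  fix s assume s: "s \<in> {-pi..pi}"
  have "norm (poisson_kernel r s) = (1 - r\<^sup>2) / (1 - 2 * r * cos s + r\<^sup>2)"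
    using pos[of s] r by (simp only: closed norm_of_real) (simp add: power_le_one)
  also have "\<dots> \<le> (2 * (1 - r)) / (((1 - r)\<^sup>2 + s\<^sup>2) / 18)"
  proof (intro frac_le)
    have "(1 + r) * (1 - r) \<le> 2 * (1 - r)" using r by (intro mult_right_mono) auto
    thus "1 - r\<^sup>2 \<le> 2 * (1 - r)" by (simp add: power2_eq_square algebra_simps)
    show "((1 - r)\<^sup>2 + s\<^sup>2) / 18 > 0" using r by (simp add: add_pos_nonneg)
    have "s\<^sup>2 / 18 \<le> 1 - cos s" by (rule one_minus_cos_ge[OF s])
    also have "\<dots> \<le> 2 * r * (1 - cos s)" using r mult_right_mono[of 1 "2 * r" "1 - cos s"] by simp
    finally have "s\<^sup>2 / 18 \<le> 2 * r * (1 - cos s)" .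
    thus "((1 - r)\<^sup>2 + s\<^sup>2) / 18 \<le> 1 - 2 * r * cos s + r\<^sup>2"
      unfolding den add_divide_distrib by (intro add_mono) auto
  qed (use r in auto)
  also have "\<dots> = 36 * ((1 - r) / ((1 - r)\<^sup>2 + s\<^sup>2))" by (simp add: field_simps)
  finally show "norm (poisson_kernel r s) \<le> 36 * ((1 - r) / ((1 - r)\<^sup>2 + s\<^sup>2))" .
qed (use r in auto)

text \<open>
  At \<open>s = \<pi>\<close>, which the reduction modulo \<open>2\<pi>\<close> sends to \<open>-\<pi>\<close>, both sides vanish because \<open>h < \<pi>\<close>.
\<close>

lemma lebesgue_kernel_eq:
  assumes "0 < h" "h < pi" "s \<in> {-pi..pi}"
  shows "lebesgue_kernel h s = complex_of_real (pi / h * indicator {-h..h} s)"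
proof (cases "s = pi")
  case True
  thus ?thesis using assms by (simp add: lebesgue_kernel_def)
next
  case False
  hence "(s + pi) rmod (2 * pi) = s + pi"
    using assms by (intro rmod_idem) auto
  thus ?thesis by (simp add: lebesgue_kernel_def)
qed

lemma peaked_kernel_lebesgue:
  assumes h: "0 < h" "h < pi"
  shows "peaked_kernel (2 * pi) h (lebesgue_kernel h)"
  unfolding peaked_kernel_def
proof (intro conjI ballI)
  have "(t + 2 * pi + pi) rmod (2 * pi) = (t + pi) rmod (2 * pi)" for t
  proof -
    have "(t + 2 * pi + pi) / (2 * pi) = (t + pi) / (2 * pi) + 1" by (simp add: field_simps)
    hence "\<lfloor>(t + 2 * pi + pi) / (2 * pi)\<rfloor> = \<lfloor>(t + pi) / (2 * pi)\<rfloor> + 1" by simp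
    thus ?thesis by (simp add: rmod_def algebra_simps)
  qed
  thus "periodic_2pi (lebesgue_kernel h)"
    by (simp add: periodic_2pi_def lebesgue_kernel_def)
  show "lebesgue_kernel h \<in> borel_measurable borel"
    unfolding lebesgue_kernel_def rmod_def by measurable
  show "circle_mean (lebesgue_kernel h) = 1"
  proof -
    have "(LINT t:{-pi..pi}|lebesgue. lebesgue_kernel h t) =
        (LINT t|lebesgue. complex_of_real (pi / h * indicator {-h..h} t))"
      unfolding set_lebesgue_integral_def
      using lebesgue_kernel_eq[OF h] h
      by (intro Bochner_Integration.integral_cong) (auto simp: indicator_def)
    also have "\<dots> = complex_of_real (2 * pi)"
      using h by simp
    finally show ?thesis by (simp add: circle_mean_def)
  qed
  fix s assume s: "s \<in> {-pi..pi}"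
  show "norm (lebesgue_kernel h s) \<le> 2 * pi * (h / (h\<^sup>2 + s\<^sup>2))"
  proof (cases "s \<in> {-h..h}")
    case True
    hence "s\<^sup>2 \<le> h\<^sup>2" using power_mono[of "\<bar>s\<bar>" h 2] by auto
    hence "2 * pi * h / (h\<^sup>2 + h\<^sup>2) \<le> 2 * pi * h / (h\<^sup>2 + s\<^sup>2)"
      using h by (intro divide_left_mono mult_pos_pos add_pos_nonneg) auto
    thus ?thesis unfolding lebesgue_kernel_eq[OF h s] norm_of_real
      using h True by (simp add: power2_eq_square)
  next
    case False
    thus ?thesis unfolding lebesgue_kernel_eq[OF h s] norm_of_real
      using h by simp
  qed
qed (use h in auto)

section \<open>Almost everywhere convergence\<close>

theorem theorem7p5:
  fixes f :: "real \<Rightarrow> complex"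
  assumes "f \<in> L1_circle"
  shows "(\<forall>n. cesaro_mean n f = circle_conv (fejer_kernel n) f)
    \<and> (AE t in lebesgue. (\<lambda>n. cesaro_mean n f t) \<longlonglongrightarrow> f t)
    \<and> (AE t in lebesgue. ((\<lambda>r. circle_conv (poisson_kernel r) f t) \<longlongrightarrow> f t) (at_left 1))
    \<and> (AE t in lebesgue. ((\<lambda>h. circle_conv (lebesgue_kernel h) f t) \<longlongrightarrow> f t) (at_right 0))"
proof -
  note conv = circle_conv_tendsto_at_lebesgue_point[OF assms]
  have points: "AE t in lebesgue. lebesgue_point f t"
    by (rule AE_lebesgue_point[OF L1_circle_absolutely_integrable[OF assms]])
  have cesaro: "cesaro_mean n f = circle_conv (fejer_kernel n) f" for n
    by (rule cesaro_mean_eq_fejer_conv[OF assms])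
  have fejer: "(\<lambda>n. cesaro_mean n f t) \<longlonglongrightarrow> f t" if "lebesgue_point f t" for t
    unfolding cesaro
  proof (rule conv[OF that])
    show "\<forall>\<^sub>F n in sequentially. peaked_kernel 38 (1 / (real n + 1)) (fejer_kernel n)"
      by (simp add: peaked_kernel_fejer)
    show "(\<lambda>n. 1 / (real n + 1)) \<longlonglongrightarrow> 0"
      using LIMSEQ_inverse_real_of_nat by (simp add: inverse_eq_divide add.commute)
  qed
  have poisson: "((\<lambda>r. circle_conv (poisson_kernel r) f t) \<longlongrightarrow> f t) (at_left 1)"
    if "lebesgue_point f t" for t
  proof (rule conv[OF that])
    show "\<forall>\<^sub>F r in at_left 1. peaked_kernel 36 (1 - r) (poisson_kernel r)"
      using eventually_at_left_field[of _ "1::real"] peaked_kernel_poisson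
      by (auto intro!: exI[of _ "1 / 2"])
    show "((\<lambda>r::real. 1 - r) \<longlongrightarrow> 0) (at_left 1)"
      by (auto intro!: tendsto_eq_intros)
  qed
  have lebesgue: "((\<lambda>h. circle_conv (lebesgue_kernel h) f t) \<longlongrightarrow> f t) (at_right 0)"
    if "lebesgue_point f t" for t
  proof (rule conv[OF that])
    show "\<forall>\<^sub>F h in at_right 0. peaked_kernel (2 * pi) h (lebesgue_kernel h)"
      using eventually_at_right_field[of _ "0::real"] peaked_kernel_lebesgue
      by (auto intro!: exI[of _ pi])
  qed (rule tendsto_ident_at)
  show ?thesis
    using cesaro points fejer poisson lebesgue by (auto elim!: eventually_mono)
qed

end
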